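(* Let $G$ be a finite simple graph with vertices $v_1,\dots,v_n$, edges $e_1,\dots,e_m$ and maximum degree $\Delta$, and let $p\geq m^2(2\Delta+2)$ be a prime. Consider the polynomial over $\mathbb{Z}_p$ in the variables $v_1,\dots,v_n,e_1,\dots,e_m$ $$\mathbf{P}(v_1,\dots,v_n,e_1,\dots,e_m)=\prod_{i=1}^{n}\Bigg(\prod_{v_j\in N_i(v_i)}(v_i-v_j)\prod_{e_j\in N_e(v_i)}(v_i-e_j)\prod_{l=\Delta+2}^{p}(v_i-l)\Bigg),$$ and let $\mathbf{P}'$ be its reduction. Then there exist integers $l_1,\dots,l_n\geq 0$ such that the coefficient $\mathcal{C}^{\mathbf{P}'}(e_1,\dots,e_m)$ of the monomial $\prod_{j=1}^n v_j^{l_j}$ in $\mathbf{P}'$ (viewing $\mathbf{P}'$ as a polynomial in $v_1,\dots,v_n$ with coefficients in $\mathbb{Z}_p[e_1,\dots,e_m]$) is not the zero polynomial.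
   Context: $N(v_i)$ is the set of neighbours of $v_i$; $N_1(v_1)=N(v_1)$ and, for $2\le i\le n$, $N_i(v_i)=N(v_i)\setminus\{v_1,\dots,v_{i-1}\}$ (an empty product equals $1$). $N_e(v_i)$ is the set of edges incident to $v_i$. The integers $l$ in $\prod_{l=\Delta+2}^p(v_i-l)$ are taken modulo $p$. For a polynomial $F$ over $\mathbb{Z}_p$, its reduction $F'$ is the polynomial obtained by repeatedly replacing $x^p$ by $x$ for each variable $x$ (Fermat's theorem), so that every variable has exponent at most $p-1$ in $F'$; $F'$ is "$\not\equiv 0 \bmod p$" if it has a monomial with nonzero coefficient in $\mathbb{Z}_p$. *)

theory Defs
  imports
    "HOL-Library.Poly_Mapping"
    "Berlekamp_Zassenhaus.Finite_Field"
begin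

definition finite_simple_graph :: "'a set \<Rightarrow> 'a set set \<Rightarrow> bool" where
  "finite_simple_graph V E \<longleftrightarrow> finite V \<and> (\<forall>e\<in>E. e \<subseteq> V \<and> card e = 2)"

definition neighbours :: "'a set set \<Rightarrow> 'a \<Rightarrow> 'a set" where
  "neighbours E x = {y. {x, y} \<in> E}"

definition incident_edges :: "'a set set \<Rightarrow> 'a \<Rightarrow> 'a set set" where
  "incident_edges E x = {e \<in> E. x \<in> e}"

text \<open>The inserted \<open>0\<close> only matters for the graph without vertices.\<close>

definition max_degree :: "'a set \<Rightarrow> 'a set set \<Rightarrow> nat" where
  "max_degree V E = Max (insert 0 ((\<lambda>x. card (neighbours E x)) ` V))"

definition later_neighbours :: "'a set set \<Rightarrow> (nat \<Rightarrow> 'a) \<Rightarrow> nat \<Rightarrow> 'a set" where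
  "later_neighbours E v i = neighbours E (v i) - v ` {1..<i}"

text \<open>
  The variables are labelled by the vertices and the edges themselves. A monomial over the
  variables \<open>'x\<close> is its finitely supported exponent function \<open>'x \<Rightarrow>\<^sub>0 nat\<close>, and polynomials are
  the elements of the monoid algebra over monomials; their product is convolution.
\<close>

datatype 'a var = Vertex 'a | Edge "'a set"

type_synonym ('x, 'r) mpolynomial = "('x \<Rightarrow>\<^sub>0 nat) \<Rightarrow>\<^sub>0 'r"

definition X :: "'x \<Rightarrow> ('x, 'r::comm_ring_1) mpolynomial" where
  "X x = Poly_Mapping.single (Poly_Mapping.single x 1) 1"

text \<open>
  Below, \<open>of_nat l\<close> is the constant polynomial whose value is the image of \<open>l\<close> in the coefficient ring,
  so over \<open>'p mod_ring\<close> it is \<open>l\<close> modulo \<open>CARD('p)\<close>.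
\<close>

definition graph_polynomial ::
  "'a set \<Rightarrow> 'a set set \<Rightarrow> (nat \<Rightarrow> 'a) \<Rightarrow> ('a var, 'p::prime_card mod_ring) mpolynomial" where
  "graph_polynomial V E v =
     (\<Prod>i = 1..card V.
        (\<Prod>w\<in>later_neighbours E v i. X (Vertex (v i)) - X (Vertex w)) *
        (\<Prod>e\<in>incident_edges E (v i). X (Vertex (v i)) - X (Edge e)) *
        (\<Prod>l = max_degree V E + 2..CARD('p). X (Vertex (v i)) - of_nat l))"

text \<open>
  One step replaces \<open>x ^ k = x ^ (k - p) * x ^ p\<close> by \<open>x ^ (k - p) * x\<close>. The guard \<open>2 \<le> p\<close>
  is there for termination.
\<close>

function reduce_exponent :: "nat \<Rightarrow> nat \<Rightarrow> nat" where
  "reduce_exponent p k =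
     (if 2 \<le> p \<and> p \<le> k then reduce_exponent p (k - p + 1) else k)"
  by pat_completeness auto
termination by (relation "measure snd") auto

declare reduce_exponent.simps [simp del]

lemma reduce_exponent_less: "2 \<le> p \<Longrightarrow> reduce_exponent p k < p"
proof (induction p k rule: reduce_exponent.induct)
  case (1 p k)
  then show ?case
    by (subst reduce_exponent.simps) auto
qed

lemma reduce_exponent_0 [simp]: "reduce_exponent p 0 = 0"
  by (subst reduce_exponent.simps) simp

definition reduction :: "('x, 'p::prime_card mod_ring) mpolynomial \<Rightarrow> ('x, 'p mod_ring) mpolynomial" where
  "reduction F =
     (\<Sum>m\<in>Poly_Mapping.keys F.
        Poly_Mapping.single (Poly_Mapping.map (reduce_exponent CARD('p)) m) (Poly_Mapping.lookup F m))"

lemma lookup_map_key_Vertex [simp]: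
  "Poly_Mapping.lookup (Poly_Mapping.map_key Vertex m) x = Poly_Mapping.lookup m (Vertex x)"
  by (simp add: map_key.rep_eq inj_def)

lemma lookup_map_key_Edge [simp]:
  "Poly_Mapping.lookup (Poly_Mapping.map_key Edge m) e = Poly_Mapping.lookup m (Edge e)"
  by (simp add: map_key.rep_eq inj_def)

text \<open>
  The ring isomorphism from \<open>R[vertices, edges]\<close> to \<open>R[edges][vertices]\<close>. Here
  \<open>map_key Vertex m\<close> and \<open>map_key Edge m\<close> are the exponents of \<open>m\<close> at the vertex and at the
  edge variables.
\<close>

definition vertex_view ::
  "('a var, 'r::comm_ring_1) mpolynomial \<Rightarrow> ('a, ('a set, 'r) mpolynomial) mpolynomial" where
  "vertex_view F =
     (\<Sum>m\<in>Poly_Mapping.keys F.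
        Poly_Mapping.single (Poly_Mapping.map_key Vertex m)
          (Poly_Mapping.single (Poly_Mapping.map_key Edge m) (Poly_Mapping.lookup F m)))"

definition vertex_coeff ::
  "('a var, 'r::comm_ring_1) mpolynomial \<Rightarrow> ('a \<Rightarrow>\<^sub>0 nat) \<Rightarrow> ('a set, 'r) mpolynomial" where
  "vertex_coeff F \<mu> = Poly_Mapping.lookup (vertex_view F) \<mu>"

end

theory Submission
  imports
    Defs
    "Berlekamp_Zassenhaus.Berlekamp_Type_Based"
begin

text \<open>
  Reduction does not change the values of a polynomial on the prime field, so it suffices to find one
  point where the graph polynomial does not vanish. Colour the vertices greedily with the residues
  \<open>1, \<dots>, \<Delta> + 1\<close> and give every edge the value \<open>0\<close>: this is legal because \<open>\<Delta> + 1 < p\<close>. A monomial of the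
  reduction with nonzero value at this point then provides the exponents.
\<close>

section \<open>Evaluation of polynomials as a ring homomorphism\<close>

definition monom_eval :: "('x \<Rightarrow> 'r::comm_ring_1) \<Rightarrow> ('x \<Rightarrow>\<^sub>0 nat) \<Rightarrow> 'r" where
  "monom_eval a m = (\<Prod>x\<in>Poly_Mapping.keys m. a x ^ Poly_Mapping.lookup m x)"

definition poly_eval :: "('x \<Rightarrow> 'r::comm_ring_1) \<Rightarrow> ('x, 'r) mpolynomial \<Rightarrow> 'r" where
  "poly_eval a F = (\<Sum>m\<in>Poly_Mapping.keys F. Poly_Mapping.lookup F m * monom_eval a m)"

text \<open>Variables outside the support contribute \<open>a x ^ 0 = 1\<close>. This allows
  monomials with different supports to be compared over one common index set;
  \<open>poly_eval_superset\<close> does the same for sums.\<close>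

lemma monom_eval_superset:
  assumes "finite S" "Poly_Mapping.keys m \<subseteq> S"
  shows "monom_eval a m = (\<Prod>x\<in>S. a x ^ Poly_Mapping.lookup m x)"
  unfolding monom_eval_def
  using assms by (intro prod.mono_neutral_left) (auto simp: in_keys_iff)

lemma poly_eval_superset:
  assumes "finite S" "Poly_Mapping.keys F \<subseteq> S"
  shows "poly_eval a F = (\<Sum>m\<in>S. Poly_Mapping.lookup F m * monom_eval a m)"
  unfolding poly_eval_def
  using assms by (intro sum.mono_neutral_left) (auto simp: in_keys_iff)

lemma monom_eval_0 [simp]: "monom_eval a 0 = 1"
  by (simp add: monom_eval_def)

lemma monom_eval_single [simp]: "monom_eval a (Poly_Mapping.single x k) = a x ^ k"
  by (simp add: monom_eval_superset[where S = "{x}"])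

lemma monom_eval_add: "monom_eval a (m + n) = monom_eval a m * monom_eval a n"
proof -
  let ?S = "Poly_Mapping.keys m \<union> Poly_Mapping.keys n"
  have "monom_eval a k = (\<Prod>x\<in>?S. a x ^ Poly_Mapping.lookup k x)" if "k \<in> {m, n, m + n}" for k
    using that keys_add[of m n] by (intro monom_eval_superset) auto
  then show ?thesis
    by (simp add: lookup_add power_add prod.distrib)
qed

lemma poly_eval_0 [simp]: "poly_eval a 0 = 0"
  by (simp add: poly_eval_def)

lemma poly_eval_single [simp]: "poly_eval a (Poly_Mapping.single m c) = c * monom_eval a m"
  by (simp add: poly_eval_superset[where S = "{m}"])

lemma poly_eval_add: "poly_eval a (F + G) = poly_eval a F + poly_eval a G"
proof -
  let ?S = "Poly_Mapping.keys F \<union> Poly_Mapping.keys G"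
  have "poly_eval a H = (\<Sum>m\<in>?S. Poly_Mapping.lookup H m * monom_eval a m)"
    if "H \<in> {F, G, F + G}" for H
    using that keys_add[of F G] by (intro poly_eval_superset) auto
  then show ?thesis
    by (simp add: lookup_add distrib_right sum.distrib)
qed

lemma poly_eval_diff: "poly_eval a (F - G) = poly_eval a F - poly_eval a G"
  using poly_eval_add[of a "F - G" G] by (simp add: algebra_simps)

lemma poly_eval_sum: "poly_eval a (\<Sum>i\<in>I. F i) = (\<Sum>i\<in>I. poly_eval a (F i))"
  by (induction I rule: infinite_finite_induct) (simp_all add: poly_eval_add)

lemma poly_mapping_eq_sum_single:
  "F = (\<Sum>m\<in>Poly_Mapping.keys F. Poly_Mapping.single m (Poly_Mapping.lookup F m))"
  by (rule poly_mapping_eqI)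
    (simp add: lookup_sum lookup_single when_def in_keys_iff)

lemma poly_eval_mult: "poly_eval a (F * G) = poly_eval a F * poly_eval a G"
proof -
  \<comment> \<open>Splitting both factors into single terms reduces the convolution to
    \<open>mult_single\<close>, so multiplicativity need only be known for monomials, where it is
    \<open>monom_eval_add\<close>.\<close>
  have "F * G = (\<Sum>m\<in>Poly_Mapping.keys F. \<Sum>n\<in>Poly_Mapping.keys G.
      Poly_Mapping.single (m + n) (Poly_Mapping.lookup F m * Poly_Mapping.lookup G n))"
    by (subst poly_mapping_eq_sum_single[of F], subst poly_mapping_eq_sum_single[of G])
      (simp add: sum_product mult_single)
  then show ?thesis
    by (simp add: poly_eval_sum monom_eval_add poly_eval_def[of a F] poly_eval_def[of a G]
        sum_product algebra_simps)
qed

lemma poly_eval_1 [simp]: "poly_eval a 1 = 1"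
  by (simp flip: single_one)

lemma poly_eval_of_nat [simp]: "poly_eval a (of_nat k) = of_nat k"
  by (induction k) (simp_all add: poly_eval_add)

lemma poly_eval_X [simp]: "poly_eval a (X x) = a x"
  by (simp add: X_def)

lemma poly_eval_prod: "poly_eval a (\<Prod>i\<in>I. F i) = (\<Prod>i\<in>I. poly_eval a (F i))"
  by (induction I rule: infinite_finite_induct) (simp_all add: poly_eval_mult)

section \<open>Reduction and evaluation over the prime field\<close>

lemma power_reduce_exponent:
  fixes c :: "'p::prime_card mod_ring"
  shows "c ^ reduce_exponent CARD('p) k = c ^ k"
proof (induction "CARD('p)" k rule: reduce_exponent.induct)
  case (1 k)
  show ?case
  proof (cases "2 \<le> CARD('p) \<and> CARD('p) \<le> k")
    case True
    \<comment> \<open>Fermat in the form \<open>c ^ p = c\<close>, which also covers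
      \<open>c = 0\<close>.\<close>
    have "c ^ (k - CARD('p) + 1) = c ^ (k - CARD('p)) * c ^ CARD('p)"
      using fermat_theorem_mod_ring[of c] by simp
    also have "\<dots> = c ^ k"
      unfolding power_add[symmetric] using True by simp
    finally show ?thesis
      using 1 True by (simp add: reduce_exponent.simps[of _ k])
  next
    case False
    then show ?thesis
      by (subst reduce_exponent.simps) auto
  qed
qed

text \<open>Distinct monomials may reduce to the same one and their coefficients may cancel. Since
  evaluation is additive, it suffices to compare values monomial by monomial.\<close>

lemma poly_eval_reduction:
  fixes F :: "('x, 'p::prime_card mod_ring) mpolynomial"
  shows "poly_eval a (reduction F) = poly_eval a F"
proof -
  have "monom_eval a (Poly_Mapping.map (reduce_exponent CARD('p)) m) = monom_eval a m" for m
  proof -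
    let ?m = "Poly_Mapping.map (reduce_exponent CARD('p)) m"
    \<comment> \<open>\<open>Poly_Mapping.map\<close> acts only on nonzero entries; this agrees with
      applying \<open>reduce_exponent\<close> everywhere because that function fixes 0.\<close>
    have lookup: "Poly_Mapping.lookup ?m x = reduce_exponent CARD('p) (Poly_Mapping.lookup m x)" for x
      by (simp add: map.rep_eq when_def)
    have "monom_eval a ?m = (\<Prod>x\<in>Poly_Mapping.keys m. a x ^ Poly_Mapping.lookup ?m x)"
      by (rule monom_eval_superset) (use lookup in \<open>auto simp: in_keys_iff intro: ccontr\<close>)
    then show ?thesis
      by (simp add: lookup power_reduce_exponent monom_eval_def)
  qed
  then show ?thesis
    by (simp add: reduction_def poly_eval_sum poly_eval_def[of a F])
qed

text \<open>A monomial is determined by its vertex part together with its edge part, so distinct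
  terms of \<open>F\<close> never merge in \<open>vertex_view F\<close>, and a nonzero coefficient
  of \<open>F\<close> survives in the two-level view.\<close>

lemma lookup_vertex_coeff:
  fixes F :: "('a var, 'r::comm_ring_1) mpolynomial"
  shows "Poly_Mapping.lookup (vertex_coeff F (Poly_Mapping.map_key Vertex m)) (Poly_Mapping.map_key Edge m) =
      Poly_Mapping.lookup F m"
proof -
  have inj: "n = m" if "Poly_Mapping.map_key Vertex n = Poly_Mapping.map_key Vertex m"
    "Poly_Mapping.map_key Edge n = Poly_Mapping.map_key Edge m" for n
  proof (rule poly_mapping_eqI)
    fix x
    show "Poly_Mapping.lookup n x = Poly_Mapping.lookup m x"
      using that[THEN arg_cong[where f = Poly_Mapping.lookup]]
      by (cases x) (metis lookup_map_key_Vertex lookup_map_key_Edge)+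
  qed
  have "Poly_Mapping.lookup (Poly_Mapping.lookup
      (Poly_Mapping.single (Poly_Mapping.map_key Vertex n)
        (Poly_Mapping.single (Poly_Mapping.map_key Edge n) c))
      (Poly_Mapping.map_key Vertex m)) (Poly_Mapping.map_key Edge m) = (if n = m then c else 0)"
    for n and c :: 'r
    using inj[of n] by (auto simp: lookup_single when_def)
  then show ?thesis
    by (simp add: vertex_coeff_def vertex_view_def lookup_sum in_keys_iff)
qed

section \<open>Greedy colouring with one colour more than the maximum degree\<close>

lemma greedy_colouring:
  assumes "finite V" and sym: "\<And>x y. y \<in> N x \<Longrightarrow> x \<in> N y" and irrefl: "\<And>x. x \<notin> N x"
    and deg: "\<And>x. x \<in> V \<Longrightarrow> finite (N x) \<and> card (N x) \<le> d"
  shows "\<exists>c :: 'a \<Rightarrow> nat. (\<forall>x\<in>V. c x \<in> {1..d + 1}) \<and> (\<forall>x\<in>V. \<forall>y\<in>V. y \<in> N x \<longrightarrow> c x \<noteq> c y)"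
  using assms(1) deg
proof (induction V rule: finite_induct)
  case empty
  then show ?case by simp
next
  case (insert u V)
  then obtain c :: "'a \<Rightarrow> nat" where c: "\<And>x. x \<in> V \<Longrightarrow> c x \<in> {1..d + 1}"
    "\<And>x y. x \<in> V \<Longrightarrow> y \<in> V \<Longrightarrow> y \<in> N x \<Longrightarrow> c x \<noteq> c y"
    by (metis insertI2)
  \<comment> \<open>At most \<open>d\<close> colours occur on the neighbours of the new vertex
    \<open>u\<close>, so one of \<open>d + 1\<close> is free. The values of \<open>c\<close> at
    neighbours not yet coloured are arbitrary, but the bound counts them too.\<close>
  have "card (c ` N u) < card {1..d + 1}"
    using card_image_le[of "N u" c] insert.prems[of u] by simp
  then have "\<not> {1..d + 1} \<subseteq> c ` N u"
    using insert.prems[of u] by (meson card_mono finite_imageI insertI1 not_le)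
  then obtain k where "k \<in> {1..d + 1}" "k \<notin> c ` N u"
    by blast
  then show ?case
    using c sym irrefl insert.hyps by (intro exI[of _ "c(u := k)"]) (auto simp: image_iff)
qed

lemma finite_neighbours:
  assumes "finite_simple_graph V E"
  shows "finite (neighbours E x)"
proof (rule finite_subset)
  show "neighbours E x \<subseteq> V" "finite V"
    using assms by (auto simp: finite_simple_graph_def neighbours_def)
qed

lemma card_neighbours_le_max_degree:
  assumes "finite_simple_graph V E" "x \<in> V"
  shows "card (neighbours E x) \<le> max_degree V E"
  using assms by (auto simp: max_degree_def finite_simple_graph_def intro!: Max_ge)

lemma proper_colouring:
  assumes G: "finite_simple_graph V E"
  shows "\<exists>c :: 'a \<Rightarrow> nat. (\<forall>x\<in>V. c x \<in> {1..max_degree V E + 1}) \<and>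
    (\<forall>x\<in>V. \<forall>y\<in>V. y \<in> neighbours E x \<longrightarrow> c x \<noteq> c y)"
proof (rule greedy_colouring)
  show "x \<notin> neighbours E x" for x
    using G by (force simp: finite_simple_graph_def neighbours_def)
qed (use G finite_neighbours[OF G] card_neighbours_le_max_degree[OF G] in
    \<open>auto simp: finite_simple_graph_def neighbours_def insert_commute\<close>)

lemma max_degree_eq_0: "max_degree V {} = 0"
proof -
  have "insert 0 ((\<lambda>x. card (neighbours {} x)) ` V) = {0}"
    by (auto simp: neighbours_def)
  then show ?thesis
    unfolding max_degree_def by (simp only: Max_singleton)
qed

text \<open>With at least one edge, the factor \<open>(card E)\<^sup>2\<close> is at least 1 and
  \<open>p\<close> is at least twice \<open>max_degree V E + 1\<close>. Without edges the degree is
  0 and \<open>1 < p\<close> gives the claim.\<close>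

lemma max_degree_less_prime:
  assumes G: "finite_simple_graph V E" and "1 < p" and p: "p \<ge> (card E)\<^sup>2 * (2 * max_degree V E + 2)"
  shows "max_degree V E + 1 < p"
proof (cases "E = {}")
  case True
  then show ?thesis
    using assms(2) by (simp add: max_degree_eq_0)
next
  case False
  have "E \<subseteq> Pow V" "finite V"
    using G by (auto simp: finite_simple_graph_def)
  then have "finite E"
    by (meson finite_Pow_iff finite_subset)
  then have "1 \<le> (card E)\<^sup>2"
    using False by (simp add: Suc_le_eq card_gt_0_iff)
  then have "1 * (2 * max_degree V E + 2) \<le> (card E)\<^sup>2 * (2 * max_degree V E + 2)"
    by (rule mult_right_mono) simp
  also note p
  finally show ?thesis
    by simp
qed

section \<open>A point where the graph polynomial does not vanish\<close>

lemma of_nat_mod_ring_neq: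
  assumes "k < l" "l - k < CARD('p::prime_card)"
  shows "(of_nat k :: 'p::prime_card mod_ring) \<noteq> of_nat l"
proof
  assume "(of_nat k :: 'p mod_ring) = of_nat l"
  then have "(of_nat (l - k) :: 'p mod_ring) = 0"
    using assms by (simp add: of_nat_diff)
  then have "CARD('p) dvd l - k"
    by (simp add: of_nat_eq_0_iff_char_dvd)
  then show False
    using assms by (auto dest: dvd_imp_le)
qed

lemma graph_polynomial_nonzero_value:
  fixes v :: "nat \<Rightarrow> 'a" and V :: "'a set"
  assumes G: "finite_simple_graph V E" and v: "v ` {1..card V} = V"
    and less: "max_degree V E + 1 < CARD('p::prime_card)"
  obtains a :: "'a var \<Rightarrow> 'p::prime_card mod_ring" where "\<And>w. w \<notin> V \<Longrightarrow> a (Vertex w) = 0"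
    and "poly_eval a (graph_polynomial V E v) \<noteq> 0"
proof -
  obtain c where c: "\<And>x. x \<in> V \<Longrightarrow> c x \<in> {1..max_degree V E + 1}"
    and proper: "\<And>x y. x \<in> V \<Longrightarrow> y \<in> V \<Longrightarrow> y \<in> neighbours E x \<Longrightarrow> c x \<noteq> c y"
    using proper_colouring[OF G] by metis
  \<comment> \<open>The factors with constants exclude exactly the residues of
    \<open>max_degree V E + 2\<close>, ..., \<open>p\<close> at a vertex, so the colours are the
    values left over. The residue 0 is not among them and can serve for all edges.\<close>
  define a :: "'a var \<Rightarrow> 'p mod_ring" where
    "a = case_var (\<lambda>w. if w \<in> V then of_nat (c w) else 0) (\<lambda>e. 0)"
  have colour: "a (Vertex x) \<noteq> a (Vertex y)" if "x \<in> V" "y \<in> neighbours E x" for x y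
  proof -
    have "y \<in> V"
      using G that by (auto simp: finite_simple_graph_def neighbours_def)
    then have "c x < c y \<or> c y < c x" "c x - c y < CARD('p)" "c y - c x < CARD('p)"
      using proper[OF that(1) _ that(2)] c[of x] c[of y] less that(1) by fastforce+
    then show ?thesis
      using of_nat_mod_ring_neq[of "c x" "c y", where 'p = 'p]
        of_nat_mod_ring_neq[of "c y" "c x", where 'p = 'p] that(1) \<open>y \<in> V\<close>
      by (auto simp: a_def)
  qed
  have edge: "a (Vertex x) \<noteq> a (Edge e)" if "x \<in> V" for x e
    using of_nat_mod_ring_neq[of 0 "c x", where 'p = 'p] c[of x] less that by (simp add: a_def)
  \<comment> \<open>The range ends at \<open>l = p\<close>, which is the residue 0. Colours start at
    1, which keeps \<open>l - c x\<close> strictly below \<open>p\<close>.\<close>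
  have list: "a (Vertex x) \<noteq> of_nat l" if "x \<in> V" "l \<in> {max_degree V E + 2..CARD('p)}" for x l
  proof -
    have "c x < l" "l - c x < CARD('p)"
      using c[of x] that by auto
    then show ?thesis
      using of_nat_mod_ring_neq[of "c x" l, where 'p = 'p] that(1) by (simp add: a_def)
  qed
  have "finite (later_neighbours E v i)" "x \<in> later_neighbours E v i \<Longrightarrow> x \<in> neighbours E (v i)" for i x
    using finite_neighbours[OF G] by (auto simp: later_neighbours_def)
  moreover have "E \<subseteq> Pow V" "finite V"
    using G by (auto simp: finite_simple_graph_def)
  then have "finite E"
    by (meson finite_Pow_iff finite_subset)
  then have "finite (incident_edges E x)" for x
    by (simp add: incident_edges_def)
  moreover have "v i \<in> V" if "i \<in> {1..card V}" for i
    using that v by blast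
  \<comment> \<open>The values lie in a field and all index sets are finite, so the product can
    vanish only if one of its factors does.\<close>
  ultimately have "poly_eval a (graph_polynomial V E v) \<noteq> 0"
    using colour edge list
    unfolding graph_polynomial_def poly_eval_prod poly_eval_mult poly_eval_diff poly_eval_X
      poly_eval_of_nat
    by (auto simp: prod_zero_iff)
  then show thesis
    by (rule that[rotated]) (simp add: a_def)
qed

section \<open>From a nonzero value to a nonzero coefficient\<close>

theorem theorem3:
  fixes V :: "'a set" and E :: "'a set set" and v :: "nat \<Rightarrow> 'a" and p :: nat
  assumes "finite_simple_graph V E"
    and "bij_betw v {1..card V} V"
    and "p = CARD('p::prime_card)"
    and "p \<ge> (card E)\<^sup>2 * (2 * max_degree V E + 2)"
  shows "\<exists>l :: nat \<Rightarrow> nat.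
    vertex_coeff (reduction (graph_polynomial V E v :: ('a var, 'p mod_ring) mpolynomial))
      (\<Sum>j = 1..card V. Poly_Mapping.single (v j) (l j)) \<noteq> 0"
proof -
  let ?P = "graph_polynomial V E v :: ('a var, 'p mod_ring) mpolynomial"
  have v: "v ` {1..card V} = V" "inj_on v {1..card V}"
    using assms(2) by (auto simp: bij_betw_def)
  have "max_degree V E + 1 < CARD('p)"
    using max_degree_less_prime[OF assms(1) _ assms(4)] assms(3)
      prime_gt_1_nat[OF prime_card[where 'a = 'p]]
    by simp
  then obtain a :: "'a var \<Rightarrow> 'p mod_ring" where a: "\<And>w. w \<notin> V \<Longrightarrow> a (Vertex w) = 0"
    and "poly_eval a ?P \<noteq> 0"
    using graph_polynomial_nonzero_value[OF assms(1) v(1)] by metis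
  then have "poly_eval a (reduction ?P) \<noteq> 0"
    by (simp add: poly_eval_reduction)
  \<comment> \<open>A nonzero sum has a nonzero term: both the coefficient of \<open>m\<close> and
    the value of \<open>m\<close> at \<open>a\<close> are nonzero.\<close>
  then obtain m where m: "m \<in> Poly_Mapping.keys (reduction ?P)" "monom_eval a m \<noteq> 0"
    unfolding poly_eval_def by (force elim: sum.not_neutral_contains_not_neutral)
  text \<open>Since \<open>a\<close> vanishes at vertices outside \<open>V\<close>, these do not occur in \<open>m\<close>.\<close>
  have outside: "Poly_Mapping.lookup m (Vertex w) = 0" if "w \<notin> V" for w
    using m(2) a[OF that] by (auto simp: monom_eval_def in_keys_iff)
  \<comment> \<open>The exponent \<open>l j\<close> is that of the vertex \<open>v j\<close> in
    \<open>m\<close>. As \<open>v\<close> enumerates \<open>V\<close> without repetition, these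
    exponents assemble to the whole vertex part of \<open>m\<close>.\<close>
  have "(\<Sum>j = 1..card V. Poly_Mapping.single (v j) (Poly_Mapping.lookup m (Vertex (v j)))) =
      (\<Sum>w\<in>V. Poly_Mapping.single w (Poly_Mapping.lookup m (Vertex w)))"
    using sum.reindex[OF v(2), of "\<lambda>w. Poly_Mapping.single w (Poly_Mapping.lookup m (Vertex w))"] v(1)
    by simp
  also have "\<dots> = Poly_Mapping.map_key Vertex m"
    using assms(1) outside
    by (intro poly_mapping_eqI) (auto simp: lookup_sum lookup_single when_def finite_simple_graph_def)
  finally have sum: "(\<Sum>j = 1..card V. Poly_Mapping.single (v j) (Poly_Mapping.lookup m (Vertex (v j)))) =
      Poly_Mapping.map_key Vertex m" .
  have "vertex_coeff (reduction ?P) (Poly_Mapping.map_key Vertex m) \<noteq> 0"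
    using m(1) lookup_vertex_coeff[of "reduction ?P" m] by (auto simp: in_keys_iff)
  then show ?thesis
    using sum by (intro exI[of _ "\<lambda>j. Poly_Mapping.lookup m (Vertex (v j))"]) simp
qed

end
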